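(* Fix $p\in(0,1)$. Then, as $n\to\infty$, \[ \max_{\sigma\in S_n}\mathcal{E}_{S_n}(\sigma) \le \Big(\frac{1+\sqrt{1-p}}{p}\Big) n + o_p(n), \] where the $o_p(n)$ term depends only on $p$ and $n$.
   Context: $S_n$ is the lattice of permutations of $[n]$ under the right weak order (generated by $\sigma\circ(i\ i{+}1)\lessdot\sigma$ whenever $\sigma(i)>\sigma(i+1)$). For $p\in(0,1]$, the Ungarian Markov chain on $S_n$ moves from $\sigma$ by selecting each descent $i$ of $\sigma$ (an index with $\sigma(i)>\sigma(i+1)$) independently with probability $p$ and moving to the meet of $\sigma$ and all $\sigma\circ(i\ i{+}1)$ for selected $i$; equivalently, all selected descents are reversed, with maximal runs of consecutive selected indices reversed as blocks. $\mathcal{E}_{S_n}(\sigma)$ denotes the expected number of steps for this chain started at $\sigma$ to reach the identity permutation. *)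

theory Defs
  imports "HOL-Probability.Probability" "HOL-Combinatorics.Multiset_Permutations"
    "HOL-Library.Landau_Symbols"
begin

text \<open>Permutations of [n] = {0..<n} are represented as lists (one-line notation),
  positions are 0-indexed.\<close>

definition perms :: "nat \<Rightarrow> nat list set" where
  "perms n = permutations_of_set {0..<n}"

definition descents :: "nat list \<Rightarrow> nat set" where
  "descents \<sigma> = {i. Suc i < length \<sigma> \<and> \<sigma> ! i > \<sigma> ! Suc i}"

text \<open>Reverse maximal blocks of positions joined by selected indices: position i and i+1
  are in the same block iff i \<in> D. The accumulator holds the current block reversed.\<close>
fun rev_blocks :: "nat set \<Rightarrow> nat \<Rightarrow> nat list \<Rightarrow> nat list \<Rightarrow> nat list" where
  "rev_blocks D i cur [] = cur"
| "rev_blocks D i cur (x # xs) =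
     (if i \<in> D then rev_blocks D (Suc i) (x # cur) xs
      else (x # cur) @ rev_blocks D (Suc i) [] xs)"

definition ungar_step :: "real \<Rightarrow> nat list \<Rightarrow> nat list pmf" where
  "ungar_step p \<sigma> =
     map_pmf (\<lambda>f. rev_blocks {i \<in> descents \<sigma>. f i} 0 [] \<sigma>)
       (Pi_pmf (descents \<sigma>) False (\<lambda>_. bernoulli_pmf p))"

definition ungar_dist :: "real \<Rightarrow> nat list \<Rightarrow> nat \<Rightarrow> nat list pmf" where
  "ungar_dist p \<sigma> t = ((\<lambda>M. bind_pmf M (ungar_step p)) ^^ t) (return_pmf \<sigma>)"

text \<open>Expected hitting time of the identity. The identity is absorbing (it has no
  descents), so the hitting time T satisfies T > t iff X_t is not the identity, and
  E[T] = sum over t of P(T > t).\<close>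
definition ungar_E :: "real \<Rightarrow> nat list \<Rightarrow> ennreal" where
  "ungar_E p \<sigma> =
     (\<Sum>t. ennreal (measure_pmf.prob (ungar_dist p \<sigma> t) {\<tau>. \<tau> \<noteq> [0..<length \<sigma>]}))"

end

theory Submission
  imports Defs "HOL-Real_Asymp.Real_Asymp"
begin

text \<open>
  Fix a threshold \<open>k\<close> and regard the entries \<open>\<ge> k\<close> as particles and the others as holes. A selected
  descent from a particle to a hole moves that particle to the right by at least one step, and no
  other selection hurts, so the particles dominate a parallel-update TASEP in which an unblocked
  particle jumps with probability \<open>p\<close>. The dominated TASEP may moreover be slowed down: its
  front particle jumps only with probability \<open>\<alpha> < p\<close>, and it is started from extra independent gaps
  that make it stationary. The gap behind a particle is then a discrete-time queue, and Burke's
  theorem for this queue shows inductively that every particle, in particular the last one,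
  performs a Bernoulli(\<open>\<alpha>\<close>) walk. Hence the word is sorted at threshold \<open>k\<close> as soon as this walk
  reaches \<open>k\<close> plus the sum of the \<open>n - k - 1\<close> initial gaps. The gaps have mean at most 1 precisely
  when \<open>\<alpha> \<le> 1 - sqrt (1 - p)\<close>, and then slightly more than \<open>n / \<alpha>\<close> steps suffice for every \<open>k\<close>; a
  Chernoff bound makes the failure probability small enough to be summed over all thresholds and times.
\<close>

section \<open>Reversing blocks of descents\<close>

definition particles_from :: "'a::linorder \<Rightarrow> nat \<Rightarrow> 'a list \<Rightarrow> nat" where
  "particles_from k v xs = length (filter ((\<le>) k) (drop v xs))"

lemma particles_from_append:
  "particles_from k v (xs @ ys) = particles_from k v xs + particles_from k (v - length xs) ys"
  by (simp add: particles_from_def)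

lemma particles_from_rec:
  "v < length xs \<Longrightarrow> particles_from k v xs = of_bool (k \<le> xs ! v) + particles_from k (Suc v) xs"
  by (simp add: particles_from_def Cons_nth_drop_Suc[symmetric])

lemma particles_from_le_length: "particles_from k v xs \<le> length xs - v"
  unfolding particles_from_def by (metis length_drop length_filter_le)

lemma particles_from_split:
  "particles_from k 0 xs = length (filter ((\<le>) k) (take v xs)) + particles_from k v xs"
  unfolding particles_from_def by (metis append_take_drop_id drop0 filter_append length_append)

lemma particles_from_0_le: "particles_from k 0 xs \<le> particles_from k v xs + v"
  using length_filter_le[of "(\<le>) k" "take v xs"] by (simp add: particles_from_split[of k xs v])

lemma particles_from_antimono:
  assumes "v \<le> w"
  shows "particles_from k w xs \<le> particles_from k v xs"
  using particles_from_split[of k "drop v xs" "w - v"] assms by (simp add: particles_from_def)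

lemma particles_from_0_cong_mset:
  "mset xs = mset ys \<Longrightarrow> particles_from k 0 xs = particles_from k 0 ys"
  unfolding particles_from_def by (metis drop0 mset_filter size_mset)

lemma particles_from_sorted:
  assumes "sorted xs"
  shows "particles_from k v xs = min (particles_from k 0 xs) (length xs - v)"
proof (cases "\<exists>x\<in>set (drop v xs). x < k")
  case True
  have "sorted (take v xs @ drop v xs)"
    using assms by simp
  then have "\<forall>x\<in>set (take v xs). \<forall>y\<in>set (drop v xs). x \<le> y"
    unfolding sorted_append by blast
  then have "filter ((\<le>) k) (take v xs) = []"
    using True by (fastforce simp: filter_empty_conv)
  then show ?thesis
    using particles_from_split[of k xs v] particles_from_le_length[of k v xs] by simp
next
  case False
  then have "filter ((\<le>) k) (drop v xs) = drop v xs"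
    by (auto simp: filter_id_conv)
  then show ?thesis
    using particles_from_antimono[of 0 v k xs] by (simp add: particles_from_def)
qed

lemma particles_from_rev_decreasing:
  assumes "sorted (rev xs)"
  shows "particles_from k v (rev xs) = min (particles_from k 0 xs) (length xs - v)"
  using particles_from_sorted[OF assms, of k v] particles_from_0_cong_mset[of "rev xs" xs k] by simp

lemma particles_from_rev_decreasing_ge:
  assumes "sorted (rev xs)"
  shows "particles_from k v xs \<le> particles_from k v (rev xs)"
  using particles_from_antimono[of 0 v k xs] particles_from_le_length[of k v xs]
  by (simp add: particles_from_rev_decreasing[OF assms])

lemma particles_from_rev_decreasing_gt:
  assumes "sorted (rev xs)" and "Suc m < length xs" "xs ! Suc m < k" "k \<le> xs ! m"
  shows "particles_from k (Suc m) xs < particles_from k (Suc m) (rev xs)"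
proof -
  have "particles_from k (Suc m) xs < particles_from k m xs"
    using assms by (simp add: particles_from_rec[of m])
  also have "\<dots> \<le> particles_from k 0 xs"
    by (rule particles_from_antimono) simp
  finally have "particles_from k (Suc m) xs < particles_from k 0 xs" .
  moreover have "particles_from k (Suc m) xs < length xs - Suc m"
    using assms(2,3) particles_from_le_length[of k "Suc (Suc m)" xs]
    by (auto simp: particles_from_rec[of "Suc m"] not_le)
  ultimately show ?thesis
    by (simp add: particles_from_rev_decreasing[OF assms(1)])
qed

lemma rev_blocks_first_block:
  "\<exists>ys zs. xs = ys @ zs \<and> (xs \<noteq> [] \<longrightarrow> ys \<noteq> []) \<and> (\<forall>j. Suc j < length ys \<longrightarrow> i + j \<in> D) \<and>
    (zs \<noteq> [] \<longrightarrow> i + length ys - 1 \<notin> D) \<and>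
    rev_blocks D i cur xs = rev ys @ cur @ rev_blocks D (i + length ys) [] zs"
proof (induction D i cur xs rule: rev_blocks.induct)
  case (2 D i cur x xs)
  show ?case
  proof (cases "i \<in> D")
    case True
    from "2.IH"(1)[OF True] obtain ys zs where
      ys: "xs = ys @ zs" "xs \<noteq> [] \<longrightarrow> ys \<noteq> []" "\<forall>j. Suc j < length ys \<longrightarrow> Suc i + j \<in> D"
        "zs \<noteq> [] \<longrightarrow> Suc i + length ys - 1 \<notin> D"
        "rev_blocks D (Suc i) (x # cur) xs = rev ys @ (x # cur) @ rev_blocks D (Suc i + length ys) [] zs"
      by blast
    have "i + j \<in> D" if "Suc j < length (x # ys)" for j
      using that True ys(3) by (cases j) auto
    then show ?thesis
      using True ys by (intro exI[of _ "x # ys"] exI[of _ zs]) auto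
  next
    case False
    then show ?thesis
      by (intro exI[of _ "[x]"] exI[of _ xs]) auto
  qed
qed simp

lemma rev_blocks_descents_induct [consumes 1, case_names Nil block]:
  assumes "{j. i + j \<in> D} \<subseteq> descents xs"
    and Nil: "\<And>i. P i []"
    and block: "\<And>i ys zs. \<lbrakk>ys \<noteq> []; sorted (rev ys); zs \<noteq> [] \<Longrightarrow> i + length ys - 1 \<notin> D;
        rev_blocks D i [] (ys @ zs) = rev ys @ rev_blocks D (i + length ys) [] zs;
        {j. i + length ys + j \<in> D} \<subseteq> descents zs; P (i + length ys) zs\<rbrakk> \<Longrightarrow> P i (ys @ zs)"
  shows "P i xs"
  using assms(1)
proof (induction "length xs" arbitrary: i xs rule: less_induct)
  case less
  show ?case
  proof (cases "xs = []")
    case False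
    obtain ys zs where ys: "xs = ys @ zs" "ys \<noteq> []" "\<And>j. Suc j < length ys \<Longrightarrow> i + j \<in> D"
        "zs \<noteq> [] \<Longrightarrow> i + length ys - 1 \<notin> D"
        "rev_blocks D i [] xs = rev ys @ rev_blocks D (i + length ys) [] zs"
      using rev_blocks_first_block[of xs i D "[]"] False by auto
    have descent: "Suc j < length xs \<and> xs ! Suc j < xs ! j" if "i + j \<in> D" for j
      using less.prems that by (auto simp: descents_def)
    have "ys ! Suc j \<le> ys ! j" if "Suc j < length ys" for j
      using descent[OF ys(3)[OF that]] that by (simp add: ys(1) nth_append)
    then have "sorted (rev ys)"
      by (simp add: sorted_rev_iff_nth_Suc)
    moreover have "{j. i + length ys + j \<in> D} \<subseteq> descents zs"
      using descent[of "length ys + _"] by (auto simp: ys(1) nth_append descents_def add.assoc)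
    moreover from this have "P (i + length ys) zs"
      using ys(1,2) by (intro less.hyps) simp_all
    ultimately show ?thesis
      using block[of ys zs i] ys by simp
  qed (simp add: Nil)
qed

lemma particles_from_rev_blocks_ge:
  assumes "{j. i + j \<in> D} \<subseteq> descents xs"
  shows "particles_from k v xs \<le> particles_from k v (rev_blocks D i [] xs)"
  using assms
proof (induction arbitrary: v rule: rev_blocks_descents_induct)
  case (block i ys zs)
  then show ?case
    by (simp add: particles_from_append add_mono particles_from_rev_decreasing_ge)
qed simp

lemma particles_from_rev_blocks_gt:
  assumes "{j. i + j \<in> D} \<subseteq> descents xs"
    and "i + m \<in> D" "Suc m < length xs" "xs ! Suc m < k" "k \<le> xs ! m"
  shows "particles_from k (Suc m) xs < particles_from k (Suc m) (rev_blocks D i [] xs)"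
  using assms
proof (induction arbitrary: m rule: rev_blocks_descents_induct)
  case (block i ys zs)
  note suffix = \<open>{j. i + length ys + j \<in> D} \<subseteq> descents zs\<close> and IH = block.IH
  show ?case
  proof (cases "Suc m < length ys")
    case True
    then have "particles_from k (Suc m) ys < particles_from k (Suc m) (rev ys)"
      using block by (intro particles_from_rev_decreasing_gt) (auto simp: nth_append)
    with particles_from_rev_blocks_ge[OF suffix, of k 0] True show ?thesis
      by (simp add: particles_from_append \<open>rev_blocks D i [] (ys @ zs) = _\<close>)
  next
    case False
    have "m \<noteq> length ys - 1"
      using block.hyps(3) block.prems(1,2) \<open>ys \<noteq> []\<close> by (cases ys) auto
    then obtain w where w: "m = length ys + w"
      using False \<open>ys \<noteq> []\<close> by (metis Suc_lessI diff_Suc_1 le_Suc_ex linorder_not_less)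
    have "particles_from k (Suc w) zs < particles_from k (Suc w) (rev_blocks D (i + length ys) [] zs)"
      using block w by (intro IH) (auto simp: nth_append add.assoc)
    moreover have "particles_from k (Suc m) ys \<le> particles_from k (Suc m) (rev ys)"
      using \<open>sorted (rev ys)\<close> by (rule particles_from_rev_decreasing_ge)
    ultimately show ?thesis
      using block w by (simp add: particles_from_append)
  qed
qed simp

lemma particle_advances:
  assumes D: "D \<subseteq> descents \<sigma>" and selected: "v \<in> descents \<sigma> \<Longrightarrow> v \<in> D" and "Suc v < length \<sigma>"
    and i: "i < particles_from k v \<sigma>" and free: "i \<le> particles_from k (Suc (Suc v)) \<sigma>"
  shows "i < particles_from k (Suc v) (rev_blocks D 0 [] \<sigma>)"
proof (cases "i < particles_from k (Suc v) \<sigma>")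
  case True
  then show ?thesis
    using particles_from_rev_blocks_ge[of 0 D \<sigma> k "Suc v"] D by simp
next
  case False
  then have crossing: "k \<le> \<sigma> ! v" "\<sigma> ! Suc v < k"
    using i free assms(3) particles_from_rec[of v \<sigma> k] particles_from_rec[of "Suc v" \<sigma> k]
    by (auto split: if_splits simp: of_bool_def)
  then have "v \<in> D"
    using selected assms(3) by (simp add: descents_def)
  then have "particles_from k (Suc v) \<sigma> < particles_from k (Suc v) (rev_blocks D 0 [] \<sigma>)"
    using particles_from_rev_blocks_gt[of 0 D \<sigma> v k] D crossing assms(3) by simp
  with free particles_from_antimono[of "Suc v" "Suc (Suc v)" k \<sigma>] show ?thesis
    by simp
qed

section \<open>Permutations\<close>

lemma perms_iff_mset: "\<sigma> \<in> perms n \<longleftrightarrow> mset \<sigma> = mset [0..<n]"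
proof -
  have "\<sigma> \<in> perms n \<longleftrightarrow> distinct \<sigma> \<and> set \<sigma> = set [0..<n]"
    by (auto simp: perms_def permutations_of_set_def)
  also have "\<dots> \<longleftrightarrow> mset \<sigma> = mset [0..<n]"
    by (metis distinct_upt mset_eq_imp_distinct_iff set_eq_iff_mset_eq_distinct)
  finally show ?thesis .
qed

lemma length_perms: "\<sigma> \<in> perms n \<Longrightarrow> length \<sigma> = n"
  by (metis perms_iff_mset mset_eq_length length_upt diff_zero)

lemma mset_rev_blocks: "mset (rev_blocks D i cur xs) = mset cur + mset xs"
  by (induction D i cur xs rule: rev_blocks.induct) auto

lemma rev_blocks_perms: "\<sigma> \<in> perms n \<Longrightarrow> rev_blocks D 0 [] \<sigma> \<in> perms n"
  by (simp add: perms_iff_mset mset_rev_blocks)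

lemma set_pmf_ungar_dist: "\<sigma> \<in> perms n \<Longrightarrow> set_pmf (ungar_dist p \<sigma> t) \<subseteq> perms n"
  by (induction t) (auto simp: ungar_dist_def ungar_step_def intro: rev_blocks_perms)

lemma particles_from_0_perms:
  assumes "\<sigma> \<in> perms n"
  shows "particles_from k 0 \<sigma> = n - k"
proof -
  have "filter ((\<le>) k) [0..<n] = [k..<n]"
    by (induction n) auto
  then show ?thesis
    using assms particles_from_0_cong_mset[of \<sigma> "[0..<n]" k]
    by (simp add: perms_iff_mset particles_from_def)
qed

definition sorted_at :: "nat \<Rightarrow> nat list \<Rightarrow> bool" where
  "sorted_at k xs \<longleftrightarrow> (\<forall>x\<in>set (drop k xs). k \<le> x)"

lemma sorted_at_if_particles_from:
  assumes "length xs - k \<le> particles_from k k xs"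
  shows "sorted_at k xs"
proof -
  have "filter ((\<le>) k) (drop k xs) = drop k xs"
    using assms unfolding particles_from_def
    by (metis filter_id_conv length_drop length_filter_less not_le)
  then show ?thesis
    by (auto simp: sorted_at_def filter_id_conv)
qed

lemma perms_eq_upt_if_sorted_at:
  assumes \<sigma>: "\<sigma> \<in> perms n" and sorted: "\<And>k. k < n \<Longrightarrow> sorted_at k \<sigma>"
  shows "\<sigma> = [0..<n]"
proof -
  have ge: "k \<le> \<sigma> ! k" if "k < n" for k
  proof -
    have "\<sigma> ! k \<in> set (drop k \<sigma>)"
      using that length_perms[OF \<sigma>] by (simp add: Cons_nth_drop_Suc[symmetric])
    then show ?thesis
      using sorted[OF that] by (simp add: sorted_at_def)
  qed
  have "sum_list \<sigma> = sum_list [0..<n]"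
    using \<sigma> by (metis perms_iff_mset sum_mset_sum_list)
  then have "(\<Sum>k<n. k) = (\<Sum>k<n. \<sigma> ! k)"
    using length_perms[OF \<sigma>] by (simp add: sum_list_sum_nth atLeast0LessThan)
  then have "\<sigma> ! k = k" if "k < n" for k
    using sum_mono_inv[of "\<lambda>k. k" "{..<n}" "(!) \<sigma>" k] ge that by auto
  then show ?thesis
    using length_perms[OF \<sigma>] by (intro nth_equalityI) auto
qed

section \<open>Exponential tail bounds\<close>

lemma nn_integral_exp_sum_list_replicate_pmf:
  fixes q :: "nat pmf"
  shows "(\<integral>\<^sup>+gs. ennreal (exp (\<theta> * real (sum_list gs))) \<partial>replicate_pmf m q) =
    (\<integral>\<^sup>+g. ennreal (exp (\<theta> * real g)) \<partial>q) ^ m"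
proof (induction m)
  case (Suc m)
  show ?case
    by (simp add: nn_integral_bind_pmf distrib_left exp_add ennreal_mult nn_integral_cmult
        nn_integral_multc Suc.IH)
qed simp

lemma prob_sum_list_replicate_pmf_ge:
  fixes q :: "nat pmf"
  assumes "0 < \<theta>" and mgf: "(\<integral>\<^sup>+g. ennreal (exp (\<theta> * real g)) \<partial>q) \<le> ennreal (exp (\<theta> * b))"
  shows "measure_pmf.prob (replicate_pmf m q) {gs. x \<le> real (sum_list gs)} \<le>
    exp (\<theta> * (b * real m - x))"
proof -
  let ?Q = "replicate_pmf m q"
  have "emeasure ?Q {gs. x \<le> real (sum_list gs)} \<le>
      ennreal (exp (- \<theta> * x)) * (\<integral>\<^sup>+gs. ennreal (exp (\<theta> * real (sum_list gs))) \<partial>?Q)"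
    using Chernoff_ineq_nn_integral_ge[OF \<open>0 < \<theta>\<close>, of UNIV ?Q "\<lambda>gs. real (sum_list gs)" x] by simp
  also have "\<dots> \<le> ennreal (exp (- \<theta> * x)) * ennreal (exp (\<theta> * b)) ^ m"
    unfolding nn_integral_exp_sum_list_replicate_pmf by (intro mult_left_mono power_mono mgf) auto
  also have "\<dots> = ennreal (exp (\<theta> * (b * real m - x)))"
    by (simp add: ennreal_power ennreal_mult[symmetric] exp_of_nat_mult[symmetric] exp_add[symmetric])
      (simp add: algebra_simps)
  finally show ?thesis
    by (simp add: measure_pmf.emeasure_eq_measure)
qed

lemma prob_shifted_sum_list_replicate_pmf_ge:
  fixes q :: "nat pmf"
  assumes "0 < \<theta>" and mgf: "(\<integral>\<^sup>+g. ennreal (exp (\<theta> * real g)) \<partial>q) \<le> ennreal (exp (\<theta> * b))"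
    and "1 \<le> b" "k + m \<le> n"
  shows "measure_pmf.prob (replicate_pmf m q) {gs. x \<le> real (k + sum_list gs)} \<le>
    exp (\<theta> * (b * real n - x))"
proof -
  have "b * real m + real k \<le> b * real m + b * real k"
    using \<open>1 \<le> b\<close> mult_right_mono[of 1 b "real k"] by simp
  also have "\<dots> \<le> b * real n"
    using \<open>1 \<le> b\<close> \<open>k + m \<le> n\<close> by (simp flip: distrib_left)
  finally have "\<theta> * (b * real m - (x - real k)) \<le> \<theta> * (b * real n - x)"
    using \<open>0 < \<theta>\<close> by (intro mult_left_mono) auto
  moreover have "{gs. x \<le> real (k + sum_list gs)} = {gs. x - real k \<le> real (sum_list gs)}"
    by auto
  ultimately show ?thesis
    using prob_sum_list_replicate_pmf_ge[OF \<open>0 < \<theta>\<close> mgf, of m "x - real k"] by (simp add: order.trans)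
qed

lemma nn_integral_exp_geometric_pmf:
  assumes p: "0 < p" "p \<le> 1" and \<theta>: "(1 - p) * exp \<theta> < 1"
  shows "(\<integral>\<^sup>+g. ennreal (exp (\<theta> * real g)) \<partial>geometric_pmf p) = ennreal (p / (1 - (1 - p) * exp \<theta>))"
proof -
  have "(\<integral>\<^sup>+g. ennreal (exp (\<theta> * real g)) \<partial>geometric_pmf p) =
      (\<Sum>g. ennreal (p * ((1 - p) * exp \<theta>) ^ g))"
    using p by (simp add: nn_integral_measure_pmf nn_integral_count_space_nat ennreal_mult[symmetric]
        exp_of_nat2_mult power_mult_distrib mult_ac)
  also have "\<dots> = ennreal (p * (1 / (1 - (1 - p) * exp \<theta>)))"
    using p \<theta> by (intro suminf_ennreal_eq sums_mult geometric_sums) auto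
  finally show ?thesis
    by simp
qed

lemma eventually_less_exp_at_right_0:
  fixes M :: "real \<Rightarrow> real"
  assumes "(M has_real_derivative \<mu>) (at 0)" "M 0 = 1" "\<mu> < b"
  shows "\<forall>\<^sub>F \<theta> in at_right 0. M \<theta> < exp (\<theta> * b)"
proof -
  have "((\<lambda>\<theta>. exp (\<theta> * b) - M \<theta>) has_real_derivative b - \<mu>) (at 0)"
    using assms(1) by (auto intro!: derivative_eq_intros)
  from DERIV_pos_inc_right[OF this] assms(2,3) obtain d where
    "0 < d" "\<And>h. 0 < h \<Longrightarrow> h < d \<Longrightarrow> M h < exp (h * b)"
    by auto
  then show ?thesis
    unfolding eventually_at_right_field by auto
qed

lemma prob_binomial_pmf_le_exp:
  assumes "0 \<le> \<alpha>" "\<alpha> \<le> 1" "\<beta> \<le> \<alpha>"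
  shows "measure_pmf.prob (binomial_pmf t \<alpha>) {N. real N \<le> \<beta> * real t} \<le>
    exp (- (2 * (\<alpha> - \<beta>)\<^sup>2) * real t)"
proof (cases "t = 0")
  case False
  interpret binomial_distribution t \<alpha>
    using assms by unfold_locales auto
  show ?thesis
    using prob_le'[of "\<alpha> - \<beta>"] False assms by (simp add: pos_divide_le_eq mult_ac)
qed simp

lemma suminf_le_geometric_tail:
  fixes f :: "nat \<Rightarrow> ennreal"
  assumes "0 \<le> \<rho>" "\<rho> < 1" "0 \<le> K" and le_1: "\<And>t. f t \<le> 1"
    and tail: "\<And>t. f (t + N) \<le> ennreal (K * \<rho> ^ t)"
  shows "(\<Sum>t. f t) \<le> ennreal (real N + K / (1 - \<rho>))"
proof -
  have "(\<Sum>t. f t) = (\<Sum>t. f (t + N)) + (\<Sum>t<N. f t)"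
    by (rule suminf_offset) simp
  also have "\<dots> \<le> (\<Sum>t. ennreal (K * \<rho> ^ t)) + (\<Sum>t<N. 1)"
    by (intro add_mono suminf_le sum_mono tail le_1) auto
  also have "(\<Sum>t. ennreal (K * \<rho> ^ t)) = ennreal (K * (1 / (1 - \<rho>)))"
    using assms(1-3) by (intro suminf_ennreal_eq sums_mult geometric_sums) auto
  also have "\<dots> + (\<Sum>t<N. 1) = ennreal (real N + K / (1 - \<rho>))"
    using assms(1-3) by (simp add: ennreal_of_nat_eq_real_of_nat add.commute)
  finally show ?thesis .
qed

lemma suminf_le_exponential_tail:
  fixes f :: "nat \<Rightarrow> ennreal"
  assumes "0 \<le> x" "0 < \<kappa>" "0 \<le> C" and le_1: "\<And>t. f t \<le> 1"
    and tail: "\<And>t. x \<le> real t \<Longrightarrow> f t \<le> ennreal (C * exp (- \<kappa> * real t))"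
  shows "(\<Sum>t. f t) \<le> ennreal (x + 1 + C * exp (- \<kappa> * x) / (1 - exp (- \<kappa>)))"
proof -
  define N where "N = nat \<lceil>x\<rceil>"
  have N: "x \<le> real N" "real N \<le> x + 1"
    using \<open>0 \<le> x\<close> unfolding N_def by linarith+
  have "f (t + N) \<le> ennreal (C * exp (- \<kappa> * x) * exp (- \<kappa>) ^ t)" for t
  proof -
    have "\<kappa> * (x + real t) \<le> \<kappa> * real (t + N)"
      using N(1) \<open>0 < \<kappa>\<close> by (intro mult_left_mono) auto
    then have "exp (- \<kappa> * real (t + N)) \<le> exp (- \<kappa> * x + real t * - \<kappa>)"
      by (simp add: algebra_simps)
    also have "\<dots> = exp (- \<kappa> * x) * exp (- \<kappa>) ^ t"
      by (simp only: exp_add exp_of_nat_mult)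
    finally have "C * exp (- \<kappa> * real (t + N)) \<le> C * exp (- \<kappa> * x) * exp (- \<kappa>) ^ t"
      unfolding mult.assoc using \<open>0 \<le> C\<close> by (intro mult_left_mono)
    with N(1) show ?thesis
      by (intro order.trans[OF tail] ennreal_leI) auto
  qed
  then have "(\<Sum>t. f t) \<le> ennreal (real N + C * exp (- \<kappa> * x) / (1 - exp (- \<kappa>)))"
    using \<open>0 < \<kappa>\<close> \<open>0 \<le> C\<close> by (intro suminf_le_geometric_tail le_1) auto
  also have "\<dots> \<le> ennreal (x + 1 + C * exp (- \<kappa> * x) / (1 - exp (- \<kappa>)))"
    using N(2) by (intro ennreal_leI) simp
  finally show ?thesis .
qed

lemma speed_margin:
  fixes \<alpha> c :: real
  assumes "0 < \<alpha>" "1 / \<alpha> < c"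
  obtains \<beta> b where "0 < c" "\<beta> < \<alpha>" "1 < b" "b < \<beta> * c"
proof -
  have "0 < c"
    using assms by (meson less_trans zero_less_divide_1_iff)
  then have "1 / c < \<alpha>"
    using assms by (simp add: field_simps)
  then obtain \<beta> where \<beta>: "1 / c < \<beta>" "\<beta> < \<alpha>"
    using dense by blast
  then have "1 < \<beta> * c"
    using \<open>0 < c\<close> by (simp add: field_simps)
  then obtain b where "1 < b" "b < \<beta> * c"
    using dense by blast
  with \<open>0 < c\<close> \<beta>(2) show ?thesis
    by (rule that)
qed

section \<open>Coin flips at the sites\<close>

lemma bernoulli_pmf_conj:
  assumes "0 \<le> p" "p \<le> 1" "0 \<le> q" "q \<le> 1"
  shows "do {b \<leftarrow> bernoulli_pmf p; c \<leftarrow> bernoulli_pmf q; return_pmf (b \<and> c)} = bernoulli_pmf (p * q)"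
proof (rule pmf_eqI)
  fix e
  have "0 \<le> p * q" "p * q \<le> 1"
    using assms by (auto intro: mult_le_one)
  with assms show "pmf (do {b \<leftarrow> bernoulli_pmf p; c \<leftarrow> bernoulli_pmf q; return_pmf (b \<and> c)}) e
    = pmf (bernoulli_pmf (p * q)) e"
    by (cases e) (simp_all add: pmf_bind indicator_def algebra_simps)
qed

lemma map_Pi_pmf_distinct:
  assumes "finite A" "distinct xs" "set xs \<subseteq> A"
  shows "map_pmf (\<lambda>f. map f xs) (Pi_pmf A dflt (\<lambda>_. q)) = replicate_pmf (length xs) q"
  using assms
proof (induction xs arbitrary: A)
  case (Cons x xs)
  let ?A = "A - {x}"
  have "Pi_pmf A dflt (\<lambda>_. q) = Pi_pmf (insert x ?A) dflt (\<lambda>_. q)"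
    using Cons.prems by (simp add: insert_absorb)
  also have "\<dots> = do {y \<leftarrow> q; f \<leftarrow> Pi_pmf ?A dflt (\<lambda>_. q); return_pmf (f(x := y))}"
    using Cons.prems by (intro Pi_pmf_insert') auto
  finally have "map_pmf (\<lambda>f. map f (x # xs)) (Pi_pmf A dflt (\<lambda>_. q)) =
      do {y \<leftarrow> q; f \<leftarrow> Pi_pmf ?A dflt (\<lambda>_. q); return_pmf (y # map (f(x := y)) xs)}"
    by (simp add: map_bind_pmf)
  also have "\<dots> = do {y \<leftarrow> q; ys \<leftarrow> map_pmf (\<lambda>f. map f xs) (Pi_pmf ?A dflt (\<lambda>_. q)); return_pmf (y # ys)}"
    unfolding bind_map_pmf using Cons.prems
    by (intro bind_pmf_cong refl) (auto intro!: arg_cong[of _ _ return_pmf] map_cong)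
  also have "map_pmf (\<lambda>f. map f xs) (Pi_pmf ?A dflt (\<lambda>_. q)) = replicate_pmf (length xs) q"
    by (intro Cons.IH) (use Cons.prems in auto)
  finally show ?case by simp
qed (simp add: map_pmf_const)

lemma finite_descents [simp]: "finite (descents \<sigma>)"
  by (rule finite_subset[of _ "{..<length \<sigma>}"]) (auto simp: descents_def)

lemma ungar_step_relabel:
  assumes "finite A" "inj h" "h ` descents \<sigma> \<subseteq> A"
  shows "ungar_step p \<sigma> =
    map_pmf (\<lambda>f. rev_blocks {i \<in> descents \<sigma>. f (h i)} 0 [] \<sigma>) (Pi_pmf A False (\<lambda>_. bernoulli_pmf p))"
proof -
  let ?B = "h ` descents \<sigma>" and ?q = "\<lambda>_. bernoulli_pmf p"
  have "Pi_pmf (descents \<sigma>) False ?q = map_pmf (\<lambda>f. f \<circ> h) (Pi_pmf ?B False ?q)"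
    using inj_on_subset[OF \<open>inj h\<close> subset_UNIV]
    by (intro Pi_pmf_bij_betw inj_on_imp_bij_betw) (auto dest: injD[OF \<open>inj h\<close>])
  also have "Pi_pmf ?B False ?q = map_pmf (\<lambda>f x. if x \<in> ?B then f x else False) (Pi_pmf A False ?q)"
    using assms by (intro Pi_pmf_subset)
  finally show ?thesis
    by (simp add: ungar_step_def map_pmf_comp inj_image_mem_iff[OF \<open>inj h\<close>] cong: conj_cong)
qed

section \<open>The TASEP in equilibrium\<close>

text \<open>
  \<open>gs\<close> lists the gaps between neighbouring particles from front to back and \<open>d\<close> is the jump of the
  front particle. The coin \<open>hd bs\<close> belongs to the particle behind the gap \<open>hd gs\<close>. The result
  consists of the new gaps and the jump of the last particle.
\<close>

fun tandem :: "bool \<Rightarrow> nat list \<Rightarrow> bool list \<Rightarrow> nat list \<times> bool" where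
  "tandem d [] bs = ([], d)"
| "tandem d (g # gs) bs =
     (let e = hd bs \<and> 0 < g in apfst ((#) (g - of_bool e + of_bool d)) (tandem e gs (tl bs)))"

lemma length_tandem [simp]: "length (fst (tandem d gs bs)) = length gs"
  by (induction d gs bs rule: tandem.induct) (simp_all add: Let_def)

text \<open>A state consists of the gaps and the displacement of the last particle.\<close>

definition tasep_move :: "nat list \<times> nat \<Rightarrow> bool \<Rightarrow> bool list \<Rightarrow> nat list \<times> nat" where
  "tasep_move = (\<lambda>(gs, N) d bs. apsnd (\<lambda>e. N + of_bool e) (tandem d gs bs))"

lemma length_tasep_move [simp]: "length (fst (tasep_move y d bs)) = length (fst y)"
  by (simp add: tasep_move_def split: prod.split)

locale tasep =
  fixes \<alpha> p :: real
  assumes rates: "0 < \<alpha>" "\<alpha> < p" "p \<le> 1"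
begin

definition idle_prob :: real where
  "idle_prob = (p - \<alpha>) / (p * (1 - \<alpha>))"

lemma one_minus_idle_prob: "1 - idle_prob = \<alpha> * (1 - p) / (p * (1 - \<alpha>))"
proof -
  have "p \<noteq> 0" "\<alpha> \<noteq> 1"
    using rates by auto
  then show ?thesis
    by (simp add: idle_prob_def divide_simps) (simp add: algebra_simps)
qed

lemma idle_prob_bounds: "0 < idle_prob" "idle_prob \<le> 1"
proof -
  show "0 < idle_prob"
    using rates by (simp add: idle_prob_def)
  have "0 \<le> 1 - idle_prob"
    unfolding one_minus_idle_prob using rates by simp
  then show "idle_prob \<le> 1"
    by simp
qed

definition residual_gap_pmf :: "nat pmf" where
  "residual_gap_pmf = geometric_pmf idle_prob"

definition gap_pmf :: "nat pmf" where
  "gap_pmf = do {d \<leftarrow> bernoulli_pmf \<alpha>; map_pmf (\<lambda>r. r + of_bool d) residual_gap_pmf}"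

lemma pmf_residual_gap_Suc:
  "p * ((1 - \<alpha>) * pmf residual_gap_pmf (Suc r)) = (1 - p) * (\<alpha> * pmf residual_gap_pmf r)"
proof -
  have "pmf residual_gap_pmf (Suc r) = (1 - idle_prob) * pmf residual_gap_pmf r"
    using idle_prob_bounds by (simp add: residual_gap_pmf_def)
  then show ?thesis
    using rates by (simp add: one_minus_idle_prob)
qed

lemma pmf_gap_0: "pmf gap_pmf 0 = (1 - \<alpha>) * pmf residual_gap_pmf 0"
  using rates by (simp add: gap_pmf_def pmf_bind pmf_map_outside)

lemma pmf_gap_Suc:
  "p * pmf gap_pmf (Suc r) = \<alpha> * pmf residual_gap_pmf r"
  "(1 - p) * pmf gap_pmf (Suc r) = (1 - \<alpha>) * pmf residual_gap_pmf (Suc r)"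
proof -
  let ?R = "pmf residual_gap_pmf"
  have "pmf gap_pmf (Suc r) = \<alpha> * ?R r + (1 - \<alpha>) * ?R (Suc r)"
    using rates by (simp add: gap_pmf_def pmf_bind pmf_map_inj')
  with pmf_residual_gap_Suc[of r] show "p * pmf gap_pmf (Suc r) = \<alpha> * ?R r"
    "(1 - p) * pmf gap_pmf (Suc r) = (1 - \<alpha>) * ?R (Suc r)"
    by algebra+
qed

text \<open>
  A gap is a queue of holes: a jump of the particle behind it serves one hole, a jump of the
  particle in front of it adds one. Service turns a stationary gap into a residual gap that is
  independent of whether a hole was served, and the arrivals turn this into a stationary gap again.
\<close>

lemma gap_service:
  "do {g \<leftarrow> gap_pmf; b \<leftarrow> bernoulli_pmf p; return_pmf (g - of_bool (b \<and> 0 < g), b \<and> 0 < g)}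
    = pair_pmf residual_gap_pmf (bernoulli_pmf \<alpha>)"
    (is "?L = ?R")
proof (rule pmf_eqI)
  fix re :: "nat \<times> bool"
  obtain r e where re: "re = (r, e)" by force
  define serve where "serve g =
    do {b \<leftarrow> bernoulli_pmf p; return_pmf (g - of_bool (b \<and> 0 < g), b \<and> 0 < g)}" for g :: nat
  have pmf_serve: "pmf (serve g) (r, e) =
     (if e then p * of_bool (g = Suc r) else (if 0 < g then 1 - p else 1) * of_bool (g = r))" for g r e
    using rates by (auto simp: serve_def pmf_bind indicator_def)
  have "pmf ?L re = (LINT g|gap_pmf. pmf (serve g) (r, e))"
    by (simp add: re serve_def pmf_bind)
  also have "\<dots> = (\<Sum>g\<in>{r, Suc r}. pmf gap_pmf g * pmf (serve g) (r, e))"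
    by (subst integral_measure_pmf[of "{r, Suc r}"]) (auto simp: pmf_serve split: if_splits)
  also have "\<dots> = pmf residual_gap_pmf r * (if e then \<alpha> else 1 - \<alpha>)"
    using pmf_gap_0 pmf_gap_Suc by (cases r) (auto simp: pmf_serve mult.commute)
  also have "\<dots> = pmf ?R re"
    using rates by (simp add: re pmf_pair)
  finally show "pmf ?L re = pmf ?R re" .
qed

lemma gap_burke:
  "do {d \<leftarrow> bernoulli_pmf \<alpha>; g \<leftarrow> gap_pmf; b \<leftarrow> bernoulli_pmf p;
      return_pmf (g - of_bool (b \<and> 0 < g) + of_bool d, b \<and> 0 < g)}
    = pair_pmf gap_pmf (bernoulli_pmf \<alpha>)"
proof -
  have "do {d \<leftarrow> bernoulli_pmf \<alpha>; g \<leftarrow> gap_pmf; b \<leftarrow> bernoulli_pmf p;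
      return_pmf (g - of_bool (b \<and> 0 < g) + of_bool d, b \<and> 0 < g)}
    = do {d \<leftarrow> bernoulli_pmf \<alpha>; (r, e) \<leftarrow> do {g \<leftarrow> gap_pmf; b \<leftarrow> bernoulli_pmf p;
        return_pmf (g - of_bool (b \<and> 0 < g), b \<and> 0 < g)}; return_pmf (r + of_bool d, e)}"
    by (simp add: bind_assoc_pmf bind_return_pmf)
  also have "\<dots> = pair_pmf gap_pmf (bernoulli_pmf \<alpha>)"
    unfolding gap_service
    by (simp add: gap_pmf_def pair_pmf_def map_pmf_def bind_assoc_pmf bind_return_pmf)
  finally show ?thesis .
qed

lemma tandem_burke:
  "do {d \<leftarrow> bernoulli_pmf \<alpha>; gs \<leftarrow> replicate_pmf m gap_pmf;
      bs \<leftarrow> replicate_pmf m (bernoulli_pmf p); return_pmf (tandem d gs bs)}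
    = pair_pmf (replicate_pmf m gap_pmf) (bernoulli_pmf \<alpha>)"
proof (induction m)
  case 0
  show ?case
    by (simp add: bind_return_pmf pair_pmf_def)
next
  case (Suc m)
  let ?A = "bernoulli_pmf \<alpha>" and ?B = "bernoulli_pmf p" and ?G = "gap_pmf"
  let ?GG = "replicate_pmf m ?G" and ?BB = "replicate_pmf m ?B"
  have "do {d \<leftarrow> ?A; gs \<leftarrow> replicate_pmf (Suc m) ?G; bs \<leftarrow> replicate_pmf (Suc m) ?B;
      return_pmf (tandem d gs bs)}
    = do {d \<leftarrow> ?A; g \<leftarrow> ?G; gs \<leftarrow> ?GG; b \<leftarrow> ?B; bs \<leftarrow> ?BB;
      return_pmf (tandem d (g # gs) (b # bs))}"
    by (simp add: bind_assoc_pmf bind_return_pmf)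
  also have "\<dots> = do {d \<leftarrow> ?A; g \<leftarrow> ?G; b \<leftarrow> ?B; gs \<leftarrow> ?GG; bs \<leftarrow> ?BB;
      return_pmf (tandem d (g # gs) (b # bs))}"
    by (subst (2) bind_commute_pmf) (rule refl)
  also have "\<dots> = do {(h, e) \<leftarrow> do {d \<leftarrow> ?A; g \<leftarrow> ?G; b \<leftarrow> ?B;
        return_pmf (g - of_bool (b \<and> 0 < g) + of_bool d, b \<and> 0 < g)};
      gs \<leftarrow> ?GG; bs \<leftarrow> ?BB; return_pmf (apfst ((#) h) (tandem e gs bs))}"
    by (simp add: bind_assoc_pmf bind_return_pmf Let_def)
  also have "\<dots> = do {h \<leftarrow> ?G; x \<leftarrow> do {e \<leftarrow> ?A; gs \<leftarrow> ?GG; bs \<leftarrow> ?BB; return_pmf (tandem e gs bs)};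
      return_pmf (apfst ((#) h) x)}"
    unfolding gap_burke by (simp add: bind_assoc_pmf bind_return_pmf pair_pmf_def)
  also have "\<dots> = pair_pmf (replicate_pmf (Suc m) ?G) ?A"
    unfolding Suc.IH by (simp add: bind_assoc_pmf bind_return_pmf pair_pmf_def)
  finally show ?case .
qed

definition tasep_step :: "nat list \<times> nat \<Rightarrow> (nat list \<times> nat) pmf" where
  "tasep_step y = do {d \<leftarrow> bernoulli_pmf \<alpha>;
     bs \<leftarrow> replicate_pmf (length (fst y)) (bernoulli_pmf p); return_pmf (tasep_move y d bs)}"

definition tasep_dist :: "nat list \<Rightarrow> nat \<Rightarrow> (nat list \<times> nat) pmf" where
  "tasep_dist gs t = ((\<lambda>M. bind_pmf M tasep_step) ^^ t) (return_pmf (gs, 0))"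

lemma tasep_step_stationary:
  "do {gs \<leftarrow> replicate_pmf m gap_pmf; tasep_step (gs, N)}
    = do {gs \<leftarrow> replicate_pmf m gap_pmf; e \<leftarrow> bernoulli_pmf \<alpha>; return_pmf (gs, N + of_bool e)}"
proof -
  let ?A = "bernoulli_pmf \<alpha>" and ?GG = "replicate_pmf m gap_pmf"
    and ?BB = "replicate_pmf m (bernoulli_pmf p)"
  have "do {gs \<leftarrow> ?GG; tasep_step (gs, N)}
    = do {gs \<leftarrow> ?GG; d \<leftarrow> ?A; bs \<leftarrow> ?BB; return_pmf (tasep_move (gs, N) d bs)}"
    by (intro bind_pmf_cong refl) (simp add: tasep_step_def set_replicate_pmf)
  also have "\<dots> = map_pmf (apsnd (\<lambda>e. N + of_bool e))
      (do {d \<leftarrow> ?A; gs \<leftarrow> ?GG; bs \<leftarrow> ?BB; return_pmf (tandem d gs bs)})"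
    by (subst bind_commute_pmf) (simp add: map_bind_pmf tasep_move_def)
  also have "\<dots> = do {gs \<leftarrow> ?GG; e \<leftarrow> ?A; return_pmf (gs, N + of_bool e)}"
    unfolding tandem_burke by (simp add: pair_pmf_def map_bind_pmf)
  finally show ?thesis .
qed

lemma tasep_dist_stationary:
  "do {gs \<leftarrow> replicate_pmf m gap_pmf; tasep_dist gs t}
    = pair_pmf (replicate_pmf m gap_pmf) (binomial_pmf t \<alpha>)"
proof (induction t)
  case 0
  then show ?case
    using rates by (simp add: tasep_dist_def pair_pmf_def bind_return_pmf binomial_pmf_0)
next
  case (Suc t)
  let ?A = "bernoulli_pmf \<alpha>" and ?GG = "replicate_pmf m gap_pmf" and ?N = "binomial_pmf t \<alpha>"
  have "do {gs \<leftarrow> ?GG; tasep_dist gs (Suc t)} =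
      do {y \<leftarrow> do {gs \<leftarrow> ?GG; tasep_dist gs t}; tasep_step y}"
    by (simp add: tasep_dist_def bind_assoc_pmf)
  also have "\<dots> = do {N \<leftarrow> ?N; gs \<leftarrow> ?GG; tasep_step (gs, N)}"
    unfolding Suc.IH pair_pmf_def bind_assoc_pmf bind_return_pmf by (rule bind_commute_pmf)
  also have "\<dots> = do {gs \<leftarrow> ?GG; N \<leftarrow> ?N; e \<leftarrow> ?A; return_pmf (gs, N + of_bool e)}"
    unfolding tasep_step_stationary by (rule bind_commute_pmf)
  also have "\<dots> = do {gs \<leftarrow> ?GG; e \<leftarrow> ?A; N \<leftarrow> ?N; return_pmf (gs, N + of_bool e)}"
    by (subst (2) bind_commute_pmf) (rule refl)
  also have "\<dots> = pair_pmf ?GG (binomial_pmf (Suc t) \<alpha>)"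
    using rates
    by (simp add: binomial_pmf_Suc pair_pmf_def bind_assoc_pmf bind_return_pmf of_bool_def add.commute)
  finally show ?case .
qed

definition initial_gaps_displacement :: "nat \<Rightarrow> nat \<Rightarrow> (nat list \<times> nat) pmf" where
  "initial_gaps_displacement m t =
     do {gs \<leftarrow> replicate_pmf m gap_pmf; map_pmf (\<lambda>y. (gs, snd y)) (tasep_dist gs t)}"

lemma map_fst_initial_gaps_displacement:
  "map_pmf fst (initial_gaps_displacement m t) = replicate_pmf m gap_pmf"
  by (simp add: initial_gaps_displacement_def map_bind_pmf map_pmf_comp map_pmf_const bind_return_pmf')

lemma map_snd_initial_gaps_displacement:
  "map_pmf snd (initial_gaps_displacement m t) = binomial_pmf t \<alpha>"
proof -
  have "map_pmf snd (initial_gaps_displacement m t) =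
      map_pmf snd (do {gs \<leftarrow> replicate_pmf m gap_pmf; tasep_dist gs t})"
    by (simp add: initial_gaps_displacement_def map_bind_pmf map_pmf_comp)
  then show ?thesis
    by (simp add: tasep_dist_stationary map_snd_pair_pmf)
qed

definition mean_gap :: real where
  "mean_gap = \<alpha> + (1 - idle_prob) / idle_prob"

lemma mean_gap_le_1:
  assumes "1 - p \<le> (1 - \<alpha>)\<^sup>2"
  shows "mean_gap \<le> 1"
proof -
  have "mean_gap = \<alpha> + \<alpha> * (1 - p) / (p - \<alpha>)"
    unfolding mean_gap_def one_minus_idle_prob using rates by (simp add: idle_prob_def)
  also have "\<dots> \<le> 1"
    using rates(2) assms by (simp add: field_simps power2_eq_square)
  finally show ?thesis .
qed

definition gap_mgf :: "real \<Rightarrow> real" where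
  "gap_mgf \<theta> = (\<alpha> * exp \<theta> + (1 - \<alpha>)) * (idle_prob / (1 - (1 - idle_prob) * exp \<theta>))"

lemma nn_integral_exp_gap:
  assumes \<theta>: "(1 - idle_prob) * exp \<theta> < 1"
  shows "(\<integral>\<^sup>+g. ennreal (exp (\<theta> * real g)) \<partial>gap_pmf) = ennreal (gap_mgf \<theta>)"
proof -
  define residual_mgf where "residual_mgf = idle_prob / (1 - (1 - idle_prob) * exp \<theta>)"
  have residual_mgf_nonneg: "0 \<le> residual_mgf"
    using idle_prob_bounds \<theta> by (simp add: residual_mgf_def)
  have "(\<integral>\<^sup>+g. ennreal (exp (\<theta> * real g)) \<partial>gap_pmf) =
      (\<integral>\<^sup>+d. ennreal (exp (\<theta> * of_bool d)) *
        (\<integral>\<^sup>+r. ennreal (exp (\<theta> * real r)) \<partial>geometric_pmf idle_prob) \<partial>bernoulli_pmf \<alpha>)"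
    by (simp add: gap_pmf_def residual_gap_pmf_def nn_integral_bind_pmf nn_integral_map_pmf
        distrib_left exp_add ennreal_mult mult.commute nn_integral_cmult[symmetric])
  also have "\<dots> = ennreal ((\<alpha> * exp \<theta> + (1 - \<alpha>)) * residual_mgf)"
    unfolding nn_integral_exp_geometric_pmf[OF idle_prob_bounds \<theta>] residual_mgf_def[symmetric]
    using rates residual_mgf_nonneg
    by (simp add: ennreal_mult[symmetric] ennreal_plus[symmetric] del: ennreal_plus)
      (simp add: algebra_simps)
  finally show ?thesis
    by (simp add: gap_mgf_def residual_mgf_def)
qed

lemma gap_exponential_moment:
  assumes "mean_gap < b"
  obtains \<theta> where "0 < \<theta>" "(\<integral>\<^sup>+g. ennreal (exp (\<theta> * real g)) \<partial>gap_pmf) \<le> ennreal (exp (\<theta> * b))"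
proof -
  have "(gap_mgf has_real_derivative mean_gap) (at 0)"
    unfolding gap_mgf_def mean_gap_def using idle_prob_bounds
    by (auto intro!: derivative_eq_intros simp: divide_simps) (auto simp: algebra_simps)
  moreover have "gap_mgf 0 = 1"
    using idle_prob_bounds by (simp add: gap_mgf_def)
  ultimately have "\<forall>\<^sub>F \<theta> in at_right 0. gap_mgf \<theta> < exp (\<theta> * b)"
    using assms by (rule eventually_less_exp_at_right_0)
  moreover have "((\<lambda>\<theta>. (1 - idle_prob) * exp \<theta>) \<longlongrightarrow> (1 - idle_prob) * exp 0) (at_right 0)"
    by (intro tendsto_intros)
  then have "\<forall>\<^sub>F \<theta> in at_right 0. (1 - idle_prob) * exp \<theta> < 1"
    by (rule order_tendstoD(2)) (use idle_prob_bounds in simp)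
  ultimately have "\<forall>\<^sub>F \<theta> in at_right 0. 0 < \<theta> \<and> gap_mgf \<theta> < exp (\<theta> * b) \<and> (1 - idle_prob) * exp \<theta> < 1"
    using eventually_at_right_less[of "0::real"] by eventually_elim simp
  then obtain \<theta> where "0 < \<theta>" "gap_mgf \<theta> < exp (\<theta> * b)" "(1 - idle_prob) * exp \<theta> < 1"
    using eventually_happens'[OF trivial_limit_at_right_real] by blast
  then show ?thesis
    by (intro that[of \<theta>]) (auto simp: nn_integral_exp_gap intro: ennreal_leI)
qed

end

section \<open>The coupling\<close>

text \<open>Particles are numbered from front to back, and the last one starts at position 0.\<close>

definition tasep_pos :: "nat list \<times> nat \<Rightarrow> nat \<Rightarrow> nat" where
  "tasep_pos = (\<lambda>(gs, N) i. N + (length gs - i) + sum_list (drop i gs))"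

lemma tasep_pos_rec:
  "i < length gs \<Longrightarrow> tasep_pos (gs, N) i = tasep_pos (gs, N) (Suc i) + Suc (gs ! i)"
  by (simp add: tasep_pos_def Cons_nth_drop_Suc[symmetric])

lemma tasep_pos_decreasing:
  assumes "i < j" "j \<le> length gs"
  shows "tasep_pos (gs, N) j < tasep_pos (gs, N) i"
  using assms
proof (induction j)
  case (Suc j)
  then show ?case
    using tasep_pos_rec[of j gs N] by (cases "i = j") simp_all
qed simp

lemma tasep_pos_0_le: "tasep_pos (gs, 0) i \<le> length gs - i + sum_list gs"
  using sum_list_append[of "take i gs" "drop i gs"] by (simp add: tasep_pos_def)

lemma tasep_pos_Cons [simp]:
  "tasep_pos (g # gs, N) 0 = Suc g + tasep_pos (gs, N) 0"
  "tasep_pos (g # gs, N) (Suc i) = tasep_pos (gs, N) i"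
  by (simp_all add: tasep_pos_def)

lemma tasep_pos_move:
  assumes "i \<le> length gs" "length bs = length gs"
  shows "tasep_pos (tasep_move (gs, N) d bs) i =
    tasep_pos (gs, N) i + of_bool (if i = 0 then d else bs ! (i - 1) \<and> 0 < gs ! (i - 1))"
  using assms
proof (induction gs arbitrary: i d bs)
  case (Cons g gs)
  then obtain b bs' where bs: "bs = b # bs'" "length bs' = length gs"
    by (cases bs) auto
  define e where "e \<longleftrightarrow> b \<and> 0 < g"
  obtain hs M where hs: "tasep_move (gs, N) e bs' = (hs, M)"
    by force
  then have move: "tasep_move (g # gs, N) d bs = ((g - of_bool e + of_bool d) # hs, M)"
    by (cases "tandem e gs bs'") (simp add: tasep_move_def bs e_def)
  have IH: "tasep_pos (hs, M) j =
      tasep_pos (gs, N) j + of_bool (if j = 0 then e else bs' ! (j - 1) \<and> 0 < gs ! (j - 1))"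
    if "j \<le> length gs" for j
    using Cons.IH[OF that bs(2), of e] by (simp only: hs)
  show ?case
  proof (cases i)
    case 0
    then show ?thesis
      using IH[of 0] unfolding move by (auto simp: e_def of_bool_def)
  next
    case (Suc j)
    then show ?thesis
      using IH[of j] Cons.prems(1) unfolding move by (cases j) (simp_all add: bs e_def)
  qed
qed (simp add: tasep_pos_def tasep_move_def)

text \<open>
  Position \<open>v\<close> of \<open>\<sigma>\<close> is site \<open>v + S\<close> of the TASEP; truncated subtraction sends the sites to the
  left of \<open>\<sigma>\<close> to position 0. Particle \<open>i\<close> of \<open>\<sigma>\<close> can get no further than position \<open>n - 1 - i\<close>, where
  nothing stops the TASEP. A step preserves the relation if both chains flip the same coin at each site.
\<close>

definition dominates :: "nat \<Rightarrow> nat \<Rightarrow> nat \<Rightarrow> nat list \<Rightarrow> nat list \<times> nat \<Rightarrow> bool" where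
  "dominates n k S \<sigma> y \<longleftrightarrow> \<sigma> \<in> perms n \<and> n = Suc (k + length (fst y)) \<and>
     (\<forall>i\<le>length (fst y). i < particles_from k (min (tasep_pos y i - S) (k + length (fst y) - i)) \<sigma>)"

lemma dominates_init:
  assumes "\<sigma> \<in> perms n" "n = Suc (k + length gs)"
  shows "dominates n k (sum_list gs) \<sigma> (gs, 0)"
proof -
  have "i < particles_from k (min (tasep_pos (gs, 0) i - sum_list gs) (k + length gs - i)) \<sigma>"
    if "i \<le> length gs" for i
  proof -
    have "i < particles_from k (length gs - i) \<sigma>"
      using particles_from_0_le[of k \<sigma> "length gs - i"] particles_from_0_perms[OF assms(1), of k]
        assms(2) that by simp
    also have "\<dots> \<le> particles_from k (min (tasep_pos (gs, 0) i - sum_list gs) (k + length gs - i)) \<sigma>"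
      using tasep_pos_0_le[of gs i] by (intro particles_from_antimono) simp
    finally show ?thesis .
  qed
  with assms show ?thesis
    by (simp add: dominates_def)
qed

lemma dominates_free_site:
  assumes dom: "dominates n k S \<sigma> (gs, N)" and i: "0 < i" "i \<le> length gs" "0 < gs ! (i - 1)"
    and v: "tasep_pos (gs, N) i = v + S" "v < k + length gs - i"
  shows "i \<le> particles_from k (Suc (Suc v)) \<sigma>"
proof -
  obtain j where j: "i = Suc j"
    using i(1) gr0_implies_Suc by blast
  have "j < particles_from k (min (tasep_pos (gs, N) j - S) (k + length gs - j)) \<sigma>"
    using dom i(2) j by (simp add: dominates_def)
  also have "\<dots> \<le> particles_from k (Suc (Suc v)) \<sigma>"
    using tasep_pos_rec[of j gs N] i v j by (intro particles_from_antimono) simp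
  finally show ?thesis
    using j by simp
qed

lemma dominates_step:
  fixes f :: "nat \<Rightarrow> bool" and c :: bool
  assumes dom: "dominates n k S \<sigma> (gs, N)"
  defines "P \<equiv> tasep_pos (gs, N)" and "D \<equiv> {v \<in> descents \<sigma>. f (v + S)}"
  defines "y' \<equiv> tasep_move (gs, N) (f (P 0) \<and> c) (map f (map (\<lambda>i. P (Suc i)) [0..<length gs]))"
  shows "dominates n k S (rev_blocks D 0 [] \<sigma>) y'"
proof -
  define m where "m = length gs"
  have \<sigma>: "\<sigma> \<in> perms n" and n: "n = Suc (k + m)"
    and ahead: "\<And>i. i \<le> m \<Longrightarrow> i < particles_from k (min (P i - S) (k + m - i)) \<sigma>"
    using dom by (auto simp: dominates_def P_def m_def)
  have D: "D \<subseteq> descents \<sigma>"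
    by (auto simp: D_def)
  define jumps where "jumps i \<longleftrightarrow> f (P i) \<and> (if i = 0 then c else 0 < gs ! (i - 1))" for i
  have P_step: "tasep_pos y' i = P i + of_bool (jumps i)" if "i \<le> m" for i
    using that by (cases i) (auto simp: y'_def tasep_pos_move jumps_def P_def m_def)
  have "i < particles_from k (min (P i + of_bool (jumps i) - S) (k + m - i)) (rev_blocks D 0 [] \<sigma>)"
    if i: "i \<le> m" for i
  proof (cases "jumps i \<and> S \<le> P i \<and> P i - S < k + m - i")
    case False
    then have "min (P i + of_bool (jumps i) - S) (k + m - i) = min (P i - S) (k + m - i)"
      by (auto simp: of_bool_def)
    with ahead[OF i] particles_from_rev_blocks_ge[of 0 D \<sigma> k] D show ?thesis
      by (auto intro: order.strict_trans2)
  next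
    case True
    define v where "v = P i - S"
    have v: "P i = v + S" "v < k + m - i" and jump: "jumps i"
      using True by (auto simp: v_def)
    have "i \<le> particles_from k (Suc (Suc v)) \<sigma>"
      using dominates_free_site[OF dom, of i v] i v jump
      by (cases "i = 0") (auto simp: jumps_def P_def m_def)
    moreover have "i < particles_from k v \<sigma>"
      using ahead[OF i] v by simp
    moreover have "f (v + S)"
      using jump v by (simp add: jumps_def)
    ultimately have "i < particles_from k (Suc v) (rev_blocks D 0 [] \<sigma>)"
      using D v(2) length_perms[OF \<sigma>] by (intro particle_advances) (auto simp: D_def n)
    then show ?thesis
      using jump v by simp
  qed
  then show ?thesis
    using P_step rev_blocks_perms[OF \<sigma>] n
    by (simp add: dominates_def m_def y'_def)
qed

lemma dominates_sorted_at:
  assumes "dominates n k S \<sigma> (gs, N)" "k + S \<le> N"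
  shows "sorted_at k \<sigma>"
proof (rule sorted_at_if_particles_from)
  let ?m = "length gs"
  have \<sigma>: "\<sigma> \<in> perms n" "n = Suc (k + ?m)"
    and "?m < particles_from k (min (tasep_pos (gs, N) ?m - S) (k + ?m - ?m)) \<sigma>"
    using assms(1) by (auto simp: dominates_def)
  moreover have "min (tasep_pos (gs, N) ?m - S) (k + ?m - ?m) = k"
    using assms(2) by (simp add: tasep_pos_def)
  ultimately show "length \<sigma> - k \<le> particles_from k k \<sigma>"
    using length_perms[OF \<sigma>(1)] by simp
qed

context tasep
begin

lemma tasep_step_sites:
  assumes "finite A" "distinct (x # xs)" "set (x # xs) \<subseteq> A" "length xs = length gs"
  shows "tasep_step (gs, N) =
    map_pmf (\<lambda>(f, c). tasep_move (gs, N) (f x \<and> c) (map f xs))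
      (pair_pmf (Pi_pmf A False (\<lambda>_. bernoulli_pmf p)) (bernoulli_pmf (\<alpha> / p)))"
    (is "_ = map_pmf ?step (pair_pmf ?F ?C)")
proof -
  let ?q = "bernoulli_pmf p" and ?move = "tasep_move (gs, N)"
  let ?qs = "replicate_pmf (length gs) ?q"
  have "map_pmf ?step (pair_pmf ?F ?C) =
      do {bs \<leftarrow> map_pmf (\<lambda>f. map f (x # xs)) ?F; c \<leftarrow> ?C; return_pmf (?move (hd bs \<and> c) (tl bs))}"
    by (simp add: pair_pmf_def map_bind_pmf bind_map_pmf)
  also have "map_pmf (\<lambda>f. map f (x # xs)) ?F = replicate_pmf (Suc (length gs)) ?q"
    using assms by (subst map_Pi_pmf_distinct) auto
  also have "do {bs \<leftarrow> replicate_pmf (Suc (length gs)) ?q; c \<leftarrow> ?C;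
        return_pmf (?move (hd bs \<and> c) (tl bs))} =
      do {b \<leftarrow> ?q; bs \<leftarrow> ?qs; c \<leftarrow> ?C; return_pmf (?move (b \<and> c) bs)}"
    by (simp add: bind_assoc_pmf bind_return_pmf)
  also have "\<dots> = do {b \<leftarrow> ?q; c \<leftarrow> ?C; bs \<leftarrow> ?qs; return_pmf (?move (b \<and> c) bs)}"
    by (subst (2) bind_commute_pmf) (rule refl)
  also have "\<dots> = do {d \<leftarrow> do {b \<leftarrow> ?q; c \<leftarrow> ?C; return_pmf (b \<and> c)}; bs \<leftarrow> ?qs; return_pmf (?move d bs)}"
    by (simp add: bind_assoc_pmf bind_return_pmf)
  also have "do {b \<leftarrow> ?q; c \<leftarrow> ?C; return_pmf (b \<and> c)} = bernoulli_pmf \<alpha>"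
    using rates by (simp add: bernoulli_pmf_conj)
  finally show ?thesis
    by (simp add: tasep_step_def)
qed

lemma rel_ungar_tasep_step:
  assumes dom: "dominates n k S \<sigma> y"
  shows "rel_pmf (dominates n k S) (ungar_step p \<sigma>) (tasep_step y)"
proof -
  obtain gs N where y: "y = (gs, N)" by force
  define P where "P = tasep_pos (gs, N)"
  let ?xs = "map (\<lambda>i. P (Suc i)) [0..<length gs]"
  define A where "A = (\<lambda>v. v + S) ` descents \<sigma> \<union> set (P 0 # ?xs)"
  define F where "F = pair_pmf (Pi_pmf A False (\<lambda>_. bernoulli_pmf p)) (bernoulli_pmf (\<alpha> / p))"
  have A: "finite A"
    by (simp add: A_def)
  have "ungar_step p \<sigma> = map_pmf (\<lambda>f. rev_blocks {v \<in> descents \<sigma>. f (v + S)} 0 [] \<sigma>) (map_pmf fst F)"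
    unfolding F_def map_fst_pair_pmf using A by (intro ungar_step_relabel) (auto simp: A_def)
  moreover have "inj_on P {0..<Suc (length gs)}"
    using tasep_pos_decreasing[of _ _ gs N] unfolding P_def
    by (intro linorder_inj_onI) (fastforce simp: less_Suc_eq_le)+
  then have "distinct (map P [0..<Suc (length gs)])"
    by (simp add: distinct_map del: upt_Suc)
  then have "tasep_step y =
      map_pmf (\<lambda>(f, c). tasep_move (gs, N) (f (P 0) \<and> c) (map f ?xs)) F"
    unfolding y F_def using A
    by (intro tasep_step_sites) (auto simp: A_def map_upt_Suc simp del: upt_Suc)
  ultimately show ?thesis
    using dominates_step[OF dom[unfolded y]]
    by (auto simp: pmf.rel_map P_def intro!: rel_pmf_reflI)
qed

lemma rel_ungar_tasep_dist:
  assumes \<sigma>: "\<sigma> \<in> perms n" and n: "n = Suc (k + length gs)"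
  shows "rel_pmf (dominates n k (sum_list gs)) (ungar_dist p \<sigma> t) (tasep_dist gs t)"
proof (induction t)
  case 0
  then show ?case
    using dominates_init[OF \<sigma> n] by (simp add: ungar_dist_def tasep_dist_def)
next
  case (Suc t)
  then show ?case
    using rel_ungar_tasep_step
    by (auto simp: ungar_dist_def tasep_dist_def intro!: rel_pmf_bindI)
qed

lemma rel_ungar_initial_gaps_displacement:
  assumes \<sigma>: "\<sigma> \<in> perms n" and k: "k < n"
  shows "rel_pmf (\<lambda>\<tau> (gs, N). k + sum_list gs \<le> N \<longrightarrow> sorted_at k \<tau>)
    (ungar_dist p \<sigma> t) (initial_gaps_displacement (n - k - 1) t)"
    (is "rel_pmf ?R _ _")
proof -
  let ?G = "replicate_pmf (n - k - 1) gap_pmf"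
  have "rel_pmf ?R (do {gs \<leftarrow> ?G; ungar_dist p \<sigma> t}) (initial_gaps_displacement (n - k - 1) t)"
    unfolding initial_gaps_displacement_def
  proof (rule rel_pmf_bindI)
    show "rel_pmf (\<lambda>gs gs'. gs = gs' \<and> length gs = n - k - 1) ?G ?G"
      by (rule rel_pmf_reflI) (simp add: set_replicate_pmf)
    fix gs gs' :: "nat list"
    assume gs: "gs = gs' \<and> length gs = n - k - 1"
    then have "rel_pmf (dominates n k (sum_list gs)) (ungar_dist p \<sigma> t) (tasep_dist gs t)"
      using k by (intro rel_ungar_tasep_dist[OF \<sigma>]) auto
    then have "rel_pmf (\<lambda>\<tau> y. ?R \<tau> (gs, snd y)) (ungar_dist p \<sigma> t) (tasep_dist gs t)"
      by (rule pmf.rel_mono_strong) (auto dest: dominates_sorted_at)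
    with gs show "rel_pmf ?R (ungar_dist p \<sigma> t) (map_pmf (\<lambda>y. (gs', snd y)) (tasep_dist gs' t))"
      by (simp add: pmf.rel_map)
  qed
  then show ?thesis
    by simp
qed

lemma prob_not_sorted_at_le:
  assumes "\<sigma> \<in> perms n" "k < n"
  shows "measure_pmf.prob (ungar_dist p \<sigma> t) {\<tau>. \<not> sorted_at k \<tau>} \<le>
    measure_pmf.prob (replicate_pmf (n - k - 1) gap_pmf) {gs. x \<le> real (k + sum_list gs)} +
    measure_pmf.prob (binomial_pmf t \<alpha>) {N. real N \<le> x}"
proof -
  let ?J = "initial_gaps_displacement (n - k - 1) t"
  let ?A = "{gs. x \<le> real (k + sum_list gs)}" and ?B = "{N. real N \<le> x}"
  have "measure_pmf.prob (ungar_dist p \<sigma> t) {\<tau>. \<not> sorted_at k \<tau>} \<le>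
      measure_pmf.prob ?J {y. \<exists>\<tau>\<in>{\<tau>. \<not> sorted_at k \<tau>}.
        case y of (gs, N) \<Rightarrow> k + sum_list gs \<le> N \<longrightarrow> sorted_at k \<tau>}"
    by (rule rel_pmf_measureD[OF rel_ungar_initial_gaps_displacement[OF assms]])
  also have "\<dots> \<le> measure_pmf.prob ?J (fst -` ?A \<union> snd -` ?B)"
    by (intro measure_pmf.finite_measure_mono) auto
  also have "\<dots> \<le> measure_pmf.prob ?J (fst -` ?A) + measure_pmf.prob ?J (snd -` ?B)"
    by (rule measure_Un_le) auto
  also have "\<dots> = measure_pmf.prob (map_pmf fst ?J) ?A + measure_pmf.prob (map_pmf snd ?J) ?B"
    by simp
  finally show ?thesis
    by (simp only: map_fst_initial_gaps_displacement map_snd_initial_gaps_displacement)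
qed

lemma prob_not_sorted_at_exponential:
  assumes mean: "mean_gap \<le> 1" and c: "1 / \<alpha> < c"
  obtains \<kappa> where "0 < \<kappa>"
    "\<And>n \<sigma> k t. \<sigma> \<in> perms n \<Longrightarrow> k < n \<Longrightarrow> c * real n \<le> real t \<Longrightarrow>
      measure_pmf.prob (ungar_dist p \<sigma> t) {\<tau>. \<not> sorted_at k \<tau>} \<le> 2 * exp (- \<kappa> * real t)"
proof -
  obtain \<beta> b where "0 < c" and \<beta>: "\<beta> < \<alpha>" and b: "1 < b" "b < \<beta> * c"
    using speed_margin[OF rates(1) c] .
  then have "mean_gap < b"
    using mean by simp
  then obtain \<theta> where \<theta>: "0 < \<theta>" "(\<integral>\<^sup>+g. ennreal (exp (\<theta> * real g)) \<partial>gap_pmf) \<le> ennreal (exp (\<theta> * b))"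
    by (rule gap_exponential_moment)
  define \<kappa> where "\<kappa> = min (\<theta> * (\<beta> - b / c)) (2 * (\<alpha> - \<beta>)\<^sup>2)"
  have "0 < \<kappa>"
    using \<theta>(1) \<beta> b(2) \<open>0 < c\<close> by (simp add: \<kappa>_def field_simps)
  moreover have "measure_pmf.prob (ungar_dist p \<sigma> t) {\<tau>. \<not> sorted_at k \<tau>} \<le> 2 * exp (- \<kappa> * real t)"
    if \<sigma>: "\<sigma> \<in> perms n" and k: "k < n" and t: "c * real n \<le> real t" for n \<sigma> k t
  proof -
    have "\<theta> * (b * real n) \<le> \<theta> * (b / c * real t)"
      using \<theta>(1) b(1) t \<open>0 < c\<close> by (intro mult_left_mono) (simp_all add: field_simps)
    moreover have "\<kappa> * real t \<le> \<theta> * (\<beta> - b / c) * real t" "\<kappa> * real t \<le> 2 * (\<alpha> - \<beta>)\<^sup>2 * real t"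
      by (intro mult_right_mono; simp add: \<kappa>_def)+
    ultimately have "exp (\<theta> * (b * real n - \<beta> * real t)) \<le> exp (- \<kappa> * real t)"
      "exp (- (2 * (\<alpha> - \<beta>)\<^sup>2) * real t) \<le> exp (- \<kappa> * real t)"
      unfolding exp_le_cancel_iff by (simp_all add: algebra_simps)
    moreover have "measure_pmf.prob (replicate_pmf (n - k - 1) gap_pmf)
        {gs. \<beta> * real t \<le> real (k + sum_list gs)} \<le> exp (\<theta> * (b * real n - \<beta> * real t))"
      using b(1) k by (intro prob_shifted_sum_list_replicate_pmf_ge[OF \<theta>]) auto
    moreover have "measure_pmf.prob (binomial_pmf t \<alpha>) {N. real N \<le> \<beta> * real t} \<le>
        exp (- (2 * (\<alpha> - \<beta>)\<^sup>2) * real t)"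
      using rates \<beta> by (intro prob_binomial_pmf_le_exp) auto
    ultimately show ?thesis
      using prob_not_sorted_at_le[OF \<sigma> k, of t "\<beta> * real t"] by linarith
  qed
  ultimately show ?thesis
    using that by blast
qed

lemma prob_not_upt_exponential:
  assumes "mean_gap \<le> 1" "1 / \<alpha> < c"
  obtains \<kappa> where "0 < \<kappa>"
    "\<And>n \<sigma> t. \<sigma> \<in> perms n \<Longrightarrow> c * real n \<le> real t \<Longrightarrow>
      measure_pmf.prob (ungar_dist p \<sigma> t) {\<tau>. \<tau> \<noteq> [0..<n]} \<le> 2 * real n * exp (- \<kappa> * real t)"
proof -
  obtain \<kappa> where \<kappa>: "0 < \<kappa>" and threshold: "\<And>n \<sigma> k t. \<sigma> \<in> perms n \<Longrightarrow> k < n \<Longrightarrow> c * real n \<le> real t \<Longrightarrow>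
      measure_pmf.prob (ungar_dist p \<sigma> t) {\<tau>. \<not> sorted_at k \<tau>} \<le> 2 * exp (- \<kappa> * real t)"
    using prob_not_sorted_at_exponential[OF assms] by blast
  have "measure_pmf.prob (ungar_dist p \<sigma> t) {\<tau>. \<tau> \<noteq> [0..<n]} \<le> 2 * real n * exp (- \<kappa> * real t)"
    if \<sigma>: "\<sigma> \<in> perms n" and t: "c * real n \<le> real t" for n \<sigma> t
  proof -
    let ?M = "ungar_dist p \<sigma> t" and ?U = "\<lambda>k. {\<tau>. \<not> sorted_at k \<tau>}"
    have "measure_pmf.prob ?M {\<tau>. \<tau> \<noteq> [0..<n]} \<le> measure_pmf.prob ?M (\<Union>k<n. ?U k)"
      using set_pmf_ungar_dist[OF \<sigma>, of p t] perms_eq_upt_if_sorted_at[of _ n]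
      by (intro measure_pmf.finite_measure_mono_AE) (auto simp: AE_measure_pmf_iff)
    also have "\<dots> \<le> (\<Sum>k<n. measure_pmf.prob ?M (?U k))"
      by (intro measure_UNION_le) auto
    also have "\<dots> \<le> (\<Sum>k<n. 2 * exp (- \<kappa> * real t))"
      using threshold[OF \<sigma> _ t] by (intro sum_mono) simp
    finally show ?thesis
      by simp
  qed
  with \<kappa> show ?thesis
    by (rule that)
qed

section \<open>The expected absorption time\<close>

lemma eventually_ungar_E_le:
  assumes mean: "mean_gap \<le> 1" and c: "1 / \<alpha> < c"
  shows "\<forall>\<^sub>F n in sequentially. \<forall>\<sigma>\<in>perms n. ungar_E p \<sigma> \<le> ennreal (c * real n)"
proof -
  obtain b where b: "1 / \<alpha> < b" "b < c"
    using dense[OF c] by blast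
  then have "0 < b"
    using rates(1) by (meson less_trans zero_less_divide_1_iff)
  obtain \<kappa> where \<kappa>: "0 < \<kappa>" and tail: "\<And>n \<sigma> t. \<sigma> \<in> perms n \<Longrightarrow> b * real n \<le> real t \<Longrightarrow>
      measure_pmf.prob (ungar_dist p \<sigma> t) {\<tau>. \<tau> \<noteq> [0..<n]} \<le> 2 * real n * exp (- \<kappa> * real t)"
    using prob_not_upt_exponential[OF mean b(1)] by blast
  define bound where "bound n =
    b * real n + 1 + 2 * real n * exp (- \<kappa> * (b * real n)) / (1 - exp (- \<kappa>))" for n :: nat
  have bound: "ungar_E p \<sigma> \<le> ennreal (bound n)" if \<sigma>: "\<sigma> \<in> perms n" for n \<sigma>
    unfolding ungar_E_def length_perms[OF \<sigma>] bound_def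
  proof (rule suminf_le_exponential_tail)
    fix t
    assume "b * real n \<le> real t"
    then show "ennreal (measure_pmf.prob (ungar_dist p \<sigma> t) {\<tau>. \<tau> \<noteq> [0..<n]}) \<le>
        ennreal (2 * real n * exp (- \<kappa> * real t))"
      by (intro ennreal_leI tail[OF \<sigma>])
  qed (use \<open>0 < b\<close> \<kappa> in simp_all)
  have "\<forall>\<^sub>F n in sequentially. bound n \<le> c * real n"
    unfolding bound_def using \<open>0 < b\<close> \<open>b < c\<close> \<kappa> by real_asymp
  then show ?thesis
  proof eventually_elim
    case (elim n)
    show ?case
      by (intro ballI order.trans[OF bound ennreal_leI[OF elim]])
  qed
qed

end

lemma exists_smallo_excess:
  fixes m :: "nat \<Rightarrow> ennreal"
  assumes "0 \<le> a" and bound: "\<And>c. a < c \<Longrightarrow> \<forall>\<^sub>F n in sequentially. m n \<le> ennreal (c * real n)"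
  shows "\<exists>f. f \<in> o(\<lambda>n. real n) \<and> (\<forall>\<^sub>F n in sequentially. m n \<le> ennreal (a * real n + f n))"
proof (intro exI conjI)
  define f where "f n = max 0 (enn2real (m n) - a * real n)" for n
  show "f \<in> o(\<lambda>n. real n)"
  proof (rule landau_o.smallI)
    fix e :: real
    assume e: "0 < e"
    then have "\<forall>\<^sub>F n in sequentially. m n \<le> ennreal ((a + e) * real n)"
      by (intro bound) simp
    then show "\<forall>\<^sub>F n in sequentially. norm (f n) \<le> e * norm (real n)"
    proof eventually_elim
      case (elim n)
      then have "enn2real (m n) \<le> (a + e) * real n"
        using \<open>0 \<le> a\<close> e by (intro enn2real_leI) auto
      with e show ?case
        by (auto simp: f_def distrib_right)
    qed
  qed
  show "\<forall>\<^sub>F n in sequentially. m n \<le> ennreal (a * real n + f n)"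
    using bound[of "a + 1", simplified]
  proof eventually_elim
    case (elim n)
    then have "m n = ennreal (enn2real (m n))"
      by (metis ennreal_enn2real ennreal_less_top order.strict_trans1)
    also have "\<dots> \<le> ennreal (a * real n + f n)"
      by (intro ennreal_leI) (simp add: f_def)
    finally show ?case .
  qed
qed

lemma tasep_critical_rate:
  fixes p :: real
  assumes "0 < p" "p < 1"
  shows "tasep (1 - sqrt (1 - p)) p" "1 - p \<le> (1 - (1 - sqrt (1 - p)))\<^sup>2"
    "(1 + sqrt (1 - p)) / p = 1 / (1 - sqrt (1 - p))"
proof -
  define s where "s = sqrt (1 - p)"
  have s: "0 < s" "s < 1" "s\<^sup>2 = 1 - p"
    using assms by (simp_all add: s_def)
  then have p: "p = (1 - s) * (1 + s)"
    by (simp add: power2_eq_square algebra_simps)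
  have "(1 - s) * 1 < (1 - s) * (1 + s)"
    using s by (intro mult_strict_left_mono) auto
  then show "tasep (1 - sqrt (1 - p)) p"
    using s assms by unfold_locales (simp_all flip: p s_def)
  show "1 - p \<le> (1 - (1 - sqrt (1 - p)))\<^sup>2"
    using s by (simp flip: s_def)
  show "(1 + sqrt (1 - p)) / p = 1 / (1 - sqrt (1 - p))"
    unfolding s_def[symmetric] using s by (subst p) simp
qed

theorem theorem3p1:
  fixes p :: real
  assumes "0 < p" and "p < 1"
  shows "\<exists>f :: nat \<Rightarrow> real. f \<in> o(\<lambda>n. real n) \<and>
    (\<forall>\<^sub>F n in at_top.
       (MAX \<sigma>\<in>perms n. ungar_E p \<sigma>) \<le> ennreal ((1 + sqrt (1 - p)) / p * real n + f n))"
proof (rule exists_smallo_excess)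
  interpret tasep "1 - sqrt (1 - p)" p
    by (rule tasep_critical_rate(1)[OF assms])
  show "0 \<le> (1 + sqrt (1 - p)) / p"
    using assms by simp
  fix c
  assume "(1 + sqrt (1 - p)) / p < c"
  then have "1 / (1 - sqrt (1 - p)) < c"
    by (simp only: tasep_critical_rate(3)[OF assms])
  then have "\<forall>\<^sub>F n in sequentially. \<forall>\<sigma>\<in>perms n. ungar_E p \<sigma> \<le> ennreal (c * real n)"
    by (rule eventually_ungar_E_le[OF mean_gap_le_1[OF tasep_critical_rate(2)[OF assms]]])
  then show "\<forall>\<^sub>F n in sequentially. (MAX \<sigma>\<in>perms n. ungar_E p \<sigma>) \<le> ennreal (c * real n)"
    by (rule eventually_mono) (auto simp: perms_def)
qed

end
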